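(* Let $z\ge 2$ and $k\ge 2$ be integers. There is no mixed Moore Abelian Cayley graph with undirected degree $r=1$, directed out-degree $z$ and diameter $k$. That is, there is no finite Abelian group $\Gamma$ with a generating set $\Sigma=\{\iota,b_1,\dots,b_z\}$ of $z+1$ distinct elements, where $\iota$ is an involution and $-b_i\notin\Sigma$ for all $i$, such that the mixed graph $\mathrm{Cay}(\Gamma,\Sigma)$ has diameter $k$ and $$|\Gamma|=M_{AC}(1,0,z,k)=\binom{k+z}{z}+\binom{k+z-1}{z}.$$
   Context: For a finite Abelian group $\Gamma$ (written additively) and a generating set $\Sigma\subseteq\Gamma\setminus\{0\}$, the Cayley graph $\mathrm{Cay}(\Gamma,\Sigma)$ has vertex set $\Gamma$, with each vertex $u$ adjacent to the vertices $u+a$, $a\in\Sigma$. If $\Sigma$ consists of $r_1$ involutions (elements of order $2$), $r_2$ pairs $\{a,-a\}$ with $a\ne-a$, and $z$ further generators $b$ with $-b\notin\Sigma$, the graph is a mixed graph with undirected degree $r=r_1+2r_2$ and directed out-degree $z$. Thus $r=1$ means $r_1=1$, $r_2=0$. Distances are measured along paths in which arcs are traversed only in their direction and edges in either direction; the diameter is the maximum distance over all ordered pairs of vertices. $M_{AC}(r_1,r_2,z,k)$ denotes the Moore-like upper bound on the order of a mixed Abelian Cayley graph with parameters $r_1,r_2,z$ and diameter $k$; for $r_1=1,r_2=0$ it equals $\binom{k+z}{z}+\binom{k+z-1}{z}$. A mixed Moore Abelian Cayley graph is a mixed Abelian Cayley graph whose order attains this bound. *)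

theory Defs
  imports "HOL-Algebra.Algebra" "Graph_Theory.Shortest_Path"
begin

text \<open>
  The mixed graph Cay(\<open>\<Gamma>\<close>, \<open>S\<close>) as a digraph. An undirected edge is represented by its two
  opposite arcs, so that directed walks traverse exactly the edges in either direction and the
  proper arcs in their own direction only.
\<close>

definition cayley_digraph :: "('a, 'm) monoid_scheme \<Rightarrow> 'a set \<Rightarrow> ('a, 'a \<times> 'a) pre_digraph" where
  "cayley_digraph \<Gamma> S =
     \<lparr>verts = carrier \<Gamma>,
      arcs = {(u, u \<otimes>\<^bsub>\<Gamma>\<^esub> a) | u a. u \<in> carrier \<Gamma> \<and> a \<in> S},
      tail = fst, head = snd\<rparr>"

text \<open>
  \<open>wf_digraph.\<mu>\<close> is specified only for well-formed digraphs; \<open>wf_digraph_cayley_digraph\<close> shows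
  that it applies to the Cayley graphs. With constant weight 1 it is the usual distance, which
  is \<open>\<infinity>\<close> for unreachable vertices.
\<close>

definition diameter :: "('a, 'b) pre_digraph \<Rightarrow> ereal" where
  "diameter G = (SUP u \<in> verts G. SUP v \<in> verts G. wf_digraph.\<mu> G (\<lambda>_. 1) u v)"

lemma wf_digraph_cayley_digraph:
  assumes "group \<Gamma>" and "S \<subseteq> carrier \<Gamma>"
  shows "wf_digraph (cayley_digraph \<Gamma> S)"
proof -
  interpret group \<Gamma> by fact
  show ?thesis
    using assms(2) by unfold_locales (auto simp: cayley_digraph_def)
qed

end

theory Submission
  imports Defs
begin

text \<open>
  A word is a multiset of generators containing the involution \<open>\<iota>\<close> at most once, of size at
  most \<open>k\<close>. There are at most as many words as the bound allows, and every group element is the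
  product of some word, so a Moore graph makes the product a bijection between words and group.
  For a generator \<open>i \<noteq> \<iota>\<close> and a word \<open>N\<close> with \<open>|N| < k\<close> and \<open>i \<notin> N\<close>, consider the group
  element \<open>N i\<^sup>-\<^sup>1\<close>. Uniqueness of words forces it to be the product of a word of size exactly
  \<open>k\<close>, and distinct pairs \<open>(i, N)\<close> to give distinct elements. But deleting all copies of one
  generator from a word of size \<open>k\<close> loses no information when the generator is remembered, and
  with a suitable choice of the deleted generator some pair \<open>(i, N)\<close> is never hit: there are
  strictly more such pairs than words of size \<open>k\<close>.
\<close>

section \<open>Products over multisets in a commutative monoid\<close>

definition mset_prod :: "('a, 'm) monoid_scheme \<Rightarrow> 'a multiset \<Rightarrow> 'a" where
  "mset_prod \<Gamma> M = (\<Otimes>\<^bsub>\<Gamma>\<^esub>x\<in>set_mset M. x [^]\<^bsub>\<Gamma>\<^esub> count M x)"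

context comm_monoid
begin

text \<open>Elements outside the support contribute a zeroth power. Enlarging the index set lets
  products of different multisets be combined over one set.\<close>

lemma mset_prod_superset:
  assumes "finite A" "A \<subseteq> carrier G" "set_mset M \<subseteq> A"
  shows "mset_prod G M = (\<Otimes>x\<in>A. x [^] count M x)"
  unfolding mset_prod_def using assms
  by (intro finprod_mono_neutral_cong_left) (auto simp: not_in_iff)

lemma mset_prod_closed [simp]:
  "set_mset M \<subseteq> carrier G \<Longrightarrow> mset_prod G M \<in> carrier G"
  unfolding mset_prod_def by (intro finprod_closed) auto

lemma mset_prod_empty [simp]: "mset_prod G {#} = \<one>"
  by (simp add: mset_prod_def)

lemma mset_prod_single [simp]: "x \<in> carrier G \<Longrightarrow> mset_prod G {#x#} = x"
  by (simp add: mset_prod_def)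

lemma mset_prod_union:
  assumes "set_mset M \<subseteq> carrier G" "set_mset N \<subseteq> carrier G"
  shows "mset_prod G (M + N) = mset_prod G M \<otimes> mset_prod G N"
proof -
  let ?A = "set_mset (M + N)"
  have A: "finite ?A" "?A \<subseteq> carrier G" using assms by auto
  have "mset_prod G (M + N) = (\<Otimes>x\<in>?A. x [^] count M x \<otimes> x [^] count N x)"
    unfolding mset_prod_def using A
    by (intro finprod_cong') (auto simp: nat_pow_mult)
  also have "\<dots> = (\<Otimes>x\<in>?A. x [^] count M x) \<otimes> (\<Otimes>x\<in>?A. x [^] count N x)"
    using A by (intro finprod_multf) auto
  also have "\<dots> = mset_prod G M \<otimes> mset_prod G N"
    using mset_prod_superset[OF A, of M] mset_prod_superset[OF A, of N] by simp
  finally show ?thesis .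
qed

lemma mset_prod_add_mset:
  assumes "x \<in> carrier G" "set_mset M \<subseteq> carrier G"
  shows "mset_prod G (add_mset x M) = mset_prod G M \<otimes> x"
  using mset_prod_union[of M "{#x#}"] assms by simp

end

section \<open>Counting words\<close>

definition words :: "'a set \<Rightarrow> 'a \<Rightarrow> nat \<Rightarrow> 'a multiset set" where
  "words B \<iota> k = {M. set_mset M \<subseteq> insert \<iota> B \<and> count M \<iota> \<le> 1 \<and> size M \<le> k}"

text \<open>Summation over exact sizes: with \<open>card A = Suc m\<close> there are
  \<open>(m + j) choose m\<close> multisets of size \<open>j\<close>, and the hockey-stick identity
  adds them up.\<close>

lemma finite_card_msets_size_le:
  assumes "finite A" "A \<noteq> {}"
  shows "finite {M. set_mset M \<subseteq> A \<and> size M \<le> n}"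
    and "card {M. set_mset M \<subseteq> A \<and> size M \<le> n} = (n + card A) choose card A"
proof -
  have eq: "{M. set_mset M \<subseteq> A \<and> size M \<le> n} = (\<Union>j\<in>{..n}. multisets_of_size A j)"
    by (auto simp: multisets_of_size_def)
  have fin: "finite (multisets_of_size A j)" for j
    using assms by (simp add: finite_multisets_of_size)
  show "finite {M. set_mset M \<subseteq> A \<and> size M \<le> n}"
    unfolding eq using fin by auto
  obtain m where m: "card A = Suc m"
    using assms by (metis card_eq_0_iff not0_implies_Suc)
  have "card (\<Union>j\<in>{..n}. multisets_of_size A j) = (\<Sum>j\<le>n. card (multisets_of_size A j))"
    using fin by (intro card_UN_disjoint) (auto simp: multisets_of_size_def)
  also have "\<dots> = (\<Sum>j\<le>n. (m + j) choose m)"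
    using assms m by (intro sum.cong refl)
      (simp add: card_multisets_of_size binomial_symmetric[of m "m + _"])
  also have "\<dots> = (n + card A) choose card A"
    by (subst choose_rising_sum(1)) (simp add: m add_ac)
  finally show "card {M. set_mset M \<subseteq> A \<and> size M \<le> n} = (n + card A) choose card A"
    by (simp add: eq)
qed

text \<open>A word without \<open>\<iota>\<close> is a multiset over \<open>B\<close> of size at
  most \<open>k\<close>; any other is \<open>\<iota>\<close> adjoined to one of size at most
  \<open>k - 1\<close>. These give the two binomials. The upper bound suffices, since words covering
  the group supply the reverse inequality.\<close>

lemma finite_card_words:
  assumes "finite B" "B \<noteq> {}" "\<iota> \<notin> B" "k \<ge> 1"
  shows "finite (words B \<iota> k)"
    and "card (words B \<iota> k) \<le>
      ((k + card B) choose card B) + ((k + card B - 1) choose card B)"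
proof -
  let ?N = "\<lambda>j. {M. set_mset M \<subseteq> B \<and> size M \<le> j}"
  note N = finite_card_msets_size_le[OF assms(1,2)]
  have sub: "words B \<iota> k \<subseteq> ?N k \<union> add_mset \<iota> ` ?N (k - 1)"
  proof
    fix M assume M: "M \<in> words B \<iota> k"
    show "M \<in> ?N k \<union> add_mset \<iota> ` ?N (k - 1)"
    proof (cases "\<iota> \<in># M")
      case True
      then obtain M' where M': "M = add_mset \<iota> M'" by (meson mset_add)
      with M have "\<iota> \<notin># M'" by (auto simp: words_def not_in_iff)
      with M M' show ?thesis by (auto simp: words_def)
    next
      case False
      with M show ?thesis by (auto simp: words_def)
    qed
  qed
  have fin: "finite (?N k \<union> add_mset \<iota> ` ?N (k - 1))" using N(1) by auto
  show "finite (words B \<iota> k)" using sub fin finite_subset by blast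
  have "card (words B \<iota> k) \<le> card (?N k) + card (add_mset \<iota> ` ?N (k - 1))"
    using card_mono[OF fin sub] card_Un_le order_trans by blast
  also have "\<dots> \<le> card (?N k) + card (?N (k - 1))"
    using card_image_le[OF N(1)] by simp
  finally show "card (words B \<iota> k) \<le>
      ((k + card B) choose card B) + ((k + card B - 1) choose card B)"
    using assms(4) by (simp add: N(2))
qed

section \<open>Short walks and words\<close>

text \<open>Deleting a pair \<open>{#\<iota>, \<iota>#}\<close> keeps the product and shortens the
  multiset, so induction on the size ends at a word.\<close>

lemma (in comm_group) reduce_to_word:
  assumes "\<iota> \<otimes> \<iota> = \<one>" "insert \<iota> B \<subseteq> carrier G"
    and "set_mset M \<subseteq> insert \<iota> B" "size M \<le> k"
  shows "\<exists>N \<in> words B \<iota> k. mset_prod G N = mset_prod G M"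
  using assms(3,4)
proof (induction "size M" arbitrary: M rule: less_induct)
  case less
  show ?case
  proof (cases "count M \<iota> \<le> 1")
    case True
    with less.prems show ?thesis by (auto simp: words_def)
  next
    case False
    then have "{#\<iota>, \<iota>#} \<subseteq># M" by (auto simp: subseteq_mset_def)
    then obtain M' where M': "M = {#\<iota>, \<iota>#} + M'" by (metis subset_mset.le_iff_add)
    have car: "\<iota> \<in> carrier G" "set_mset M' \<subseteq> carrier G"
      using assms(2) less.prems(1) M' by auto
    have "mset_prod G M = mset_prod G M' \<otimes> (\<iota> \<otimes> \<iota>)"
      using car by (simp add: M' mset_prod_add_mset m_assoc)
    then have "mset_prod G M = mset_prod G M'"
      using car assms(1) by simp
    with less.hyps[of M'] less.prems M' show ?thesis by auto
  qed
qed

text \<open>Commutativity makes the order of the arcs irrelevant: the multiset of generators used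
  along the walk determines its end.\<close>

lemma (in comm_group) awalk_cayley_mset_prod:
  assumes "S \<subseteq> carrier G" "pre_digraph.awalk (cayley_digraph G S) u p v"
  shows "\<exists>M. set_mset M \<subseteq> S \<and> size M = length p \<and> v = u \<otimes> mset_prod G M"
proof -
  interpret wf_digraph "cayley_digraph G S"
    using assms(1) by (intro wf_digraph_cayley_digraph) unfold_locales
  show ?thesis using assms(2)
  proof (induction p arbitrary: u)
    case Nil
    then have "u = v" "u \<in> verts (cayley_digraph G S)"
      by (auto simp: awalk_Nil_iff)
    then have "u = v" "u \<in> carrier G"
      by (auto simp: cayley_digraph_def)
    then show ?case by (intro exI[of _ "{#}"]) simp
  next
    case (Cons e p)
    then have e: "e \<in> arcs (cayley_digraph G S)" "u = tail (cayley_digraph G S) e"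
      and p: "awalk (head (cayley_digraph G S) e) p v"
      by (simp_all add: awalk_Cons_iff)
    from e obtain a where a: "a \<in> S" "u \<in> carrier G" "head (cayley_digraph G S) e = u \<otimes> a"
      by (auto simp: cayley_digraph_def)
    from Cons.IH[OF p[unfolded a(3)]] obtain M where M: "set_mset M \<subseteq> S" "size M = length p"
      "v = u \<otimes> a \<otimes> mset_prod G M" by blast
    have "v = u \<otimes> mset_prod G (add_mset a M)"
      using a(1,2) M assms(1) by (subst mset_prod_add_mset) (auto simp: m_ac subset_iff)
    with a M show ?case by (intro exI[of _ "add_mset a M"]) auto
  qed
qed

lemma (in comm_group) diameter_cayley_mset_prod:
  assumes "S \<subseteq> carrier G" "diameter (cayley_digraph G S) \<le> ereal (real k)"
    and "v \<in> carrier G"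
  shows "\<exists>M. set_mset M \<subseteq> S \<and> size M \<le> k \<and> v = mset_prod G M"
proof -
  interpret wf_digraph "cayley_digraph G S"
    using assms(1) by (intro wf_digraph_cayley_digraph) unfold_locales
  have "\<mu> (\<lambda>_. 1) \<one> v \<le> diameter (cayley_digraph G S)"
    unfolding diameter_def using assms(3)
    by (intro SUP_upper2[of "\<one>"] SUP_upper2[of v]) (auto simp: cayley_digraph_def)
  \<comment> \<open>The distance is an infimum; a strict bound yields an actual walk, and
    integrality brings its length down to \<open>k\<close>.\<close>
  also have "\<dots> < ereal (real k + 1)"
    using assms(2) by (rule order.strict_trans1) simp
  finally obtain p where p: "awalk \<one> p v" "awalk_cost (\<lambda>_. 1) p < real k + 1"
    unfolding \<mu>_def by (auto simp: INF_less_iff)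
  have "length p \<le> k"
    using p(2) by (simp add: awalk_cost_def sum_list_triv)
  moreover obtain M where "set_mset M \<subseteq> S" "size M = length p" "v = \<one> \<otimes> mset_prod G M"
    using awalk_cayley_mset_prod[OF assms(1) p(1)] by blast
  ultimately show ?thesis
    using assms(1) by (intro exI[of _ M]) auto
qed

section \<open>Counting the elements \<open>N i\<^sup>-\<^sup>1\<close> in two ways\<close>

text \<open>The condition \<open>i \<notin># N\<close> rules out cancellation in
  \<open>N i\<^sup>-\<^sup>1\<close>; \<open>size N < k\<close> leaves room to adjoin one more
  generator.\<close>

definition shifts :: "'a set \<Rightarrow> 'a \<Rightarrow> nat \<Rightarrow> ('a \<times> 'a multiset) set" where
  "shifts B \<iota> k = {(i, N). i \<in> B \<and> N \<in> words B \<iota> k \<and> size N < k \<and> i \<notin># N}"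

lemma (in comm_group) card_shifts_le:
  assumes B: "insert \<iota> B \<subseteq> carrier G" "\<iota> \<notin> B"
    and fin: "finite (words B \<iota> k)"
    and bij: "bij_betw (mset_prod G) (words B \<iota> k) (carrier G)"
  shows "card (shifts B \<iota> k) \<le> card {M \<in> words B \<iota> k. size M = k}"
proof -
  let ?W = "words B \<iota> k"
  have inj: "M = N" if "M \<in> ?W" "N \<in> ?W" "mset_prod G M = mset_prod G N" for M N
    using bij that by (auto simp: bij_betw_def inj_on_def)
  have car: "set_mset M \<subseteq> carrier G" if "M \<in> ?W" for M
    using that B by (auto simp: words_def)
  have add: "add_mset i M \<in> ?W" if "M \<in> ?W" "size M < k" "i \<in> B" for i M
    using that B by (auto simp: words_def)
  \<comment> \<open>The unique word representing \<open>N i\<^sup>-\<^sup>1\<close>.\<close>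
  define f where "f = (\<lambda>(i, N). inv_into ?W (mset_prod G) (mset_prod G N \<otimes> inv i))"
  have f: "f (i, N) \<in> ?W" "mset_prod G (f (i, N)) \<otimes> i = mset_prod G N"
    if "(i, N) \<in> shifts B \<iota> k" for i N
  proof -
    have i: "i \<in> carrier G" "mset_prod G N \<in> carrier G"
      using that B car by (auto simp: shifts_def)
    then have "mset_prod G N \<otimes> inv i \<in> mset_prod G ` ?W"
      using bij by (simp add: bij_betw_def)
    then show "f (i, N) \<in> ?W" "mset_prod G (f (i, N)) \<otimes> i = mset_prod G N"
      using i by (auto simp: f_def inv_into_into f_inv_into_f m_assoc)
  qed
  have "inj_on f (shifts B \<iota> k)"
  proof (rule inj_onI, clarify)
    fix i N j M
    assume iN: "(i, N) \<in> shifts B \<iota> k" and jM: "(j, M) \<in> shifts B \<iota> k"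
      and eq: "f (i, N) = f (j, M)"
    have ij: "i \<in> carrier G" "j \<in> carrier G" using iN jM B by (auto simp: shifts_def)
    have NM: "N \<in> ?W" "M \<in> ?W" using iN jM by (auto simp: shifts_def)
    have "mset_prod G N \<otimes> j = mset_prod G M \<otimes> i"
      using f(2)[OF iN] f(2)[OF jM] mset_prod_closed[OF car[OF f(1)[OF iN]]] ij eq
      by (metis m_assoc m_comm)
    \<comment> \<open>Both sides are words because \<open>N\<close> and \<open>M\<close> are shorter
      than \<open>k\<close>, so uniqueness applies.\<close>
    then have "add_mset j N = add_mset i M"
      using iN jM ij car NM
      by (intro inj add) (auto simp: shifts_def mset_prod_add_mset)
    \<comment> \<open>If \<open>i \<noteq> j\<close>, the equation would put \<open>i\<close> into
      \<open>N\<close>.\<close>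
    with iN show "i = j \<and> N = M"
      by (auto simp: shifts_def add_eq_conv_ex)
  qed
  moreover have "size (f (i, N)) = k" if iN: "(i, N) \<in> shifts B \<iota> k" for i N
  proof (rule ccontr)
    assume "size (f (i, N)) \<noteq> k"
    with f(1)[OF iN] have less: "size (f (i, N)) < k" by (auto simp: words_def)
    have "add_mset i (f (i, N)) = N"
      using iN f[OF iN] car[OF f(1)[OF iN]] less B
      by (intro inj add) (auto simp: shifts_def mset_prod_add_mset)
    then have "i \<in># N" by (metis union_single_eq_member)
    with iN show False by (simp add: shifts_def)
  qed
  ultimately show ?thesis
    using f(1) fin by (intro card_inj_on_le[of f]) auto
qed

lemma card_shifts_gt:
  assumes fin: "finite (words B \<iota> k)" "finite B"
    and ab: "a \<in> B" "b \<in> B" "a \<noteq> b" "\<iota> \<notin> B" and k: "k \<ge> 2"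
  shows "card {M \<in> words B \<iota> k. size M = k} < card (shifts B \<iota> k)"
proof -
  let ?L = "{M \<in> words B \<iota> k. size M = k}"
  \<comment> \<open>Deleting \<open>a\<close> whenever possible is what leaves the pair \<open>(b, {#a#})\<close> outside the image.\<close>
  define c where "c = (\<lambda>M. if a \<in># M then a else (SOME i. i \<in># M \<and> i \<in> B))"
  define g where "g = (\<lambda>M. (c M, filter_mset (\<lambda>x. x \<noteq> c M) M))"
  have c: "c M \<in># M \<and> c M \<in> B" if M: "M \<in> ?L" for M
  proof -
    \<comment> \<open>A word using only \<open>\<iota>\<close> has size at most 1, below
      \<open>k\<close>.\<close>
    have "\<exists>i. i \<in># M \<and> i \<in> B"
    proof (rule ccontr)
      assume "\<not> ?thesis"
      with M have "set_mset M \<subseteq> {\<iota>}" by (auto simp: words_def)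
      then have "size M = count M \<iota>"
        by (metis count_replicate_mset set_mset_subset_singletonD)
      with M k show False by (auto simp: words_def)
    qed
    from someI_ex[OF this] show ?thesis using ab by (auto simp: c_def)
  qed
  have split: "M = replicate_mset (count M i) i + filter_mset (\<lambda>x. x \<noteq> i) M"
    for M :: "'a multiset" and i
    by (rule multiset_eqI) auto
  have size_g: "size M = count M (c M) + size (snd (g M))" for M
    unfolding g_def by (subst split[of M "c M"]) (simp del: count_filter_mset)
  have inj: "inj_on g ?L"
  proof (rule inj_onI)
    fix M N assume MN: "M \<in> ?L" "N \<in> ?L" "g M = g N"
    then have "c M = c N" by (simp add: g_def)
    \<comment> \<open>The lost multiplicity is \<open>k\<close> minus the size of what
      remains.\<close>
    moreover have "count M (c M) = count N (c N)"
      using MN size_g[of M] size_g[of N] by simp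
    moreover have "filter_mset (\<lambda>x. x \<noteq> c M) M = filter_mset (\<lambda>x. x \<noteq> c N) N"
      using MN(3) unfolding g_def prod.inject by blast
    ultimately show "M = N" using split[of M "c M"] split[of N "c N"] by simp
  qed
  have sub: "g ` ?L \<subseteq> shifts B \<iota> k"
  proof
    fix x assume "x \<in> g ` ?L"
    then obtain M where M: "M \<in> ?L" "x = g M" by blast
    have "size (snd (g M)) < k"
      using size_g[of M] c[OF M(1)] M(1)
      by (auto simp flip: count_greater_zero_iff)
    with c[OF M(1)] M show "x \<in> shifts B \<iota> k"
      by (auto simp: shifts_def words_def g_def)
  qed
  have b: "(b, {#a#}) \<in> shifts B \<iota> k - g ` ?L"
  proof -
    have "(b, {#a#}) \<noteq> g M" for M
    proof
      assume eq: "(b, {#a#}) = g M"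
      then have "{#a#} = filter_mset (\<lambda>x. x \<noteq> c M) M" by (simp add: g_def)
      then have "a \<in># filter_mset (\<lambda>x. x \<noteq> c M) M" by (metis union_single_eq_member)
      then have "a \<in># M" by simp
      then show False using eq ab by (simp add: g_def c_def)
    qed
    moreover have "(b, {#a#}) \<in> shifts B \<iota> k"
      using ab k by (auto simp: shifts_def words_def)
    ultimately show ?thesis by auto
  qed
  have "finite (shifts B \<iota> k)"
    by (rule finite_subset[of _ "B \<times> words B \<iota> k"]) (auto simp: shifts_def fin)
  then have "card (g ` ?L) < card (shifts B \<iota> k)"
    using sub b by (intro psubset_card_mono) auto
  then show ?thesis using card_image[OF inj] by simp
qed

theorem theorem3p2:
  fixes z k :: nat
  assumes "z \<ge> 2" and "k \<ge> 2"
  shows "\<not> (\<exists>(\<Gamma> :: 'a monoid) S \<iota> (b :: nat \<Rightarrow> 'a).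
            comm_group \<Gamma> \<and> finite (carrier \<Gamma>) \<and>
            S \<subseteq> carrier \<Gamma> - {\<one>\<^bsub>\<Gamma>\<^esub>} \<and> generate \<Gamma> S = carrier \<Gamma> \<and>
            S = insert \<iota> (b ` {1..z}) \<and> card S = z + 1 \<and>
            group.ord \<Gamma> \<iota> = 2 \<and>
            (\<forall>i \<in> {1..z}. inv\<^bsub>\<Gamma>\<^esub> (b i) \<notin> S) \<and>
            diameter (cayley_digraph \<Gamma> S) = ereal (real k) \<and>
            order \<Gamma> = ((k + z) choose z) + ((k + z - 1) choose z))"
proof (intro notI, elim exE conjE)
  fix \<Gamma> :: "'a monoid" and S \<iota> and b :: "nat \<Rightarrow> 'a"
  assume "comm_group \<Gamma>"
    and S: "S \<subseteq> carrier \<Gamma> - {\<one>\<^bsub>\<Gamma>\<^esub>}" "S = insert \<iota> (b ` {1..z})" "card S = z + 1"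
    and ord: "group.ord \<Gamma> \<iota> = 2"
    and diam: "diameter (cayley_digraph \<Gamma> S) = ereal (real k)"
    and order: "order \<Gamma> = ((k + z) choose z) + ((k + z - 1) choose z)"
  interpret comm_group \<Gamma> by fact
  define B where "B = b ` {1..z}"
  have SB: "S = insert \<iota> B" "insert \<iota> B \<subseteq> carrier \<Gamma>" "finite B"
    using S by (auto simp: B_def)
  have "card B \<le> z" using card_image_le[of "{1..z}" b] by (simp add: B_def)
  moreover have card_insert: "card (insert \<iota> B) = z + 1" using S(3) by (simp only: SB(1))
  \<comment> \<open>Otherwise \<open>S = B\<close> would have at most \<open>z\<close>
    elements.\<close>
  ultimately have \<iota>B: "\<iota> \<notin> B" by (metis Suc_eq_plus1 insert_absorb not_less_eq_eq order_refl)
  then have cardB: "card B = z" using card_insert SB(3) by simp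
  have "\<not> card B \<le> Suc 0" using assms(1) cardB by simp
  then obtain a a' where a: "a \<in> B" "a' \<in> B" "a \<noteq> a'"
    by (auto simp: card_le_Suc0_iff_eq[OF SB(3)])
  have \<iota>: "\<iota> \<in> carrier \<Gamma>" "\<iota> \<otimes>\<^bsub>\<Gamma>\<^esub> \<iota> = \<one>\<^bsub>\<Gamma>\<^esub>"
    using SB(2) pow_ord_eq_1[of \<iota>] ord by (simp_all add: numeral_2_eq_2)
  let ?W = "words B \<iota> k"
  have W: "finite ?W" "card ?W \<le> card (carrier \<Gamma>)"
    using finite_card_words[OF SB(3) _ \<iota>B, of k] a assms(2) order
    by (auto simp: cardB order_def)
  have img: "mset_prod \<Gamma> ` ?W = carrier \<Gamma>"
  proof
    show "mset_prod \<Gamma> ` ?W \<subseteq> carrier \<Gamma>"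
      using SB(2) by (auto simp: words_def intro!: mset_prod_closed)
    show "carrier \<Gamma> \<subseteq> mset_prod \<Gamma> ` ?W"
    proof
      fix v assume "v \<in> carrier \<Gamma>"
      then obtain M where "set_mset M \<subseteq> S" "size M \<le> k" "v = mset_prod \<Gamma> M"
        using diameter_cayley_mset_prod[of S k v] diam S(1) by auto
      then obtain N where "N \<in> ?W" "v = mset_prod \<Gamma> N"
        using reduce_to_word[OF \<iota>(2) SB(2), of M k] unfolding SB(1) by metis
      then show "v \<in> mset_prod \<Gamma> ` ?W" by blast
    qed
  qed
  \<comment> \<open>A surjection from a finite set onto a set at least as large is injective; this
    is where attaining the bound enters.\<close>
  have "inj_on (mset_prod \<Gamma>) ?W"
    using W card_image_le[OF W(1), of "mset_prod \<Gamma>"] img by (intro eq_card_imp_inj_on) auto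
  with img have "bij_betw (mset_prod \<Gamma>) ?W (carrier \<Gamma>)" by (simp add: bij_betw_def)
  then show False
    using card_shifts_le[OF SB(2) \<iota>B W(1)] card_shifts_gt[OF W(1) SB(3) a \<iota>B assms(2)] by simp
qed

end
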